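(* If $b$ is a positive integer with $b \equiv 120 \pmod{330}$, then there exists a $v$-palindrome in base $b$.
   Context: Natural numbers are positive integers. Let $b\ge 2$ be an integer. Every natural number $n$ has a unique base $b$ representation $n=a_0+a_1b+\cdots+a_{L-1}b^{L-1}$ with integers $L\ge 1$, $0\le a_i<b$, and $a_{L-1}\ne 0$. The digit reversal of $n$ in base $b$ is $r_b(n)=a_{L-1}+a_{L-2}b+\cdots+a_0b^{L-1}$. The function $v$ on natural numbers is defined as follows: if $n=p_1^{\varepsilon_1}\cdots p_s^{\varepsilon_s}q_1\cdots q_t$ is the prime factorization of $n$, where $s,t\ge 0$, the exponents $\varepsilon_1,\ldots,\varepsilon_s\ge 2$ are integers, and $p_1,\ldots,p_s,q_1,\ldots,q_t$ are distinct primes, then $v(n)=\sum_{i=1}^s (p_i+\varepsilon_i)+\sum_{j=1}^t q_j$ (so $v(1)=0$). A natural number $n$ is a $v$-palindrome in base $b$ if (i) $b\nmid n$, (ii) $n\ne r_b(n)$, and (iii) $v(n)=v(r_b(n))$. *)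

theory Defs
  imports "HOL-Number_Theory.Number_Theory"
begin

text \<open>Digit lists are little-endian: \<open>horner_sum id b [a\<^sub>0, a\<^sub>1, ...]\<close> is
  \<open>a\<^sub>0 + a\<^sub>1 * b + ...\<close>, so the last element of the list is the leading digit.\<close>

definition base_repr :: "nat \<Rightarrow> nat \<Rightarrow> nat list \<Rightarrow> bool" where
  "base_repr b n ds \<longleftrightarrow>
     ds \<noteq> [] \<and> (\<forall>d\<in>set ds. d < b) \<and> last ds \<noteq> 0 \<and> n = horner_sum id b ds"

definition digits :: "nat \<Rightarrow> nat \<Rightarrow> nat list" where
  "digits b n = (THE ds. base_repr b n ds)"

definition digit_reversal :: "nat \<Rightarrow> nat \<Rightarrow> nat" where
  "digit_reversal b n = horner_sum id b (rev (digits b n))"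

definition v :: "nat \<Rightarrow> nat" where
  "v n = (\<Sum>p\<in>prime_factors n.
            if multiplicity p n \<ge> 2 then p + multiplicity p n else p)"

text \<open>Only meaningful for \<open>b \<ge> 2\<close>.\<close>

definition v_palindrome :: "nat \<Rightarrow> nat \<Rightarrow> bool" where
  "v_palindrome b n \<longleftrightarrow>
     n > 0 \<and> \<not> b dvd n \<and> n \<noteq> digit_reversal b n \<and> v n = v (digit_reversal b n)"

lemma base_repr_exists:
  assumes "b \<ge> 2" "n > 0"
  shows "\<exists>ds. base_repr b n ds"
  using assms(2)
proof (induction n rule: less_induct)
  case (less n)
  show ?case
  proof (cases "n < b")
    case True
    then have "base_repr b n [n]"
      using less.prems by (simp add: base_repr_def)
    then show ?thesis ..
  next
    case False
    then have "n div b < n" "n div b > 0"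
      using assms(1) less.prems by (simp_all add: div_greater_zero_iff)
    then obtain ds where "base_repr b (n div b) ds"
      using less.IH by blast
    then have "base_repr b n (n mod b # ds)"
      using assms(1) by (auto simp: base_repr_def) (metis mod_mult_div_eq)
    then show ?thesis ..
  qed
qed

lemma base_repr_unique:
  assumes "base_repr b n ds" "base_repr b n es"
  shows "ds = es"
  using assms
proof (induction ds arbitrary: n es)
  case Nil
  then show ?case by (simp add: base_repr_def)
next
  case (Cons d ds)
  have pos: "horner_sum id b xs > 0" if "xs \<noteq> []" "last xs \<noteq> 0" "b > 0" for xs :: "nat list"
    using that by (induction xs) (auto split: if_splits)
  obtain e es' where es: "es = e # es'"
    using Cons.prems(2) by (cases es) (auto simp: base_repr_def)
  have lt: "d < b" "e < b"
    using Cons.prems es by (auto simp: base_repr_def)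
  have eq: "d + b * horner_sum id b ds = e + b * horner_sum id b es'"
    using Cons.prems es by (simp add: base_repr_def)
  have de: "d = e"
    using arg_cong[OF eq, of "\<lambda>x. x mod b"] lt by simp
  have hs: "horner_sum id b ds = horner_sum id b es'"
    using eq de lt by simp
  show ?case
  proof (cases "ds = []")
    case True
    then have "es' = []"
      using pos[of es'] hs lt Cons.prems(2) es by (auto simp: base_repr_def split: if_splits)
    with True de es show ?thesis by simp
  next
    case False
    then have "horner_sum id b ds > 0"
      using pos[of ds] lt Cons.prems(1) by (auto simp: base_repr_def)
    then have "es' \<noteq> []"
      using hs by auto
    then have "base_repr b (horner_sum id b ds) ds" "base_repr b (horner_sum id b ds) es'"
      using Cons.prems es False hs by (auto simp: base_repr_def)
    then have "ds = es'"
      by (rule Cons.IH)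
    with de es show ?thesis by simp
  qed
qed

lemma digits_eqI: "base_repr b n ds \<Longrightarrow> digits b n = ds"
  unfolding digits_def by (blast intro: the_equality base_repr_unique)

lemma base_repr_digits:
  assumes "b \<ge> 2" "n > 0"
  shows "base_repr b n (digits b n)"
  using base_repr_exists[OF assms] digits_eqI by blast

end

theory Submission
  imports Defs
begin

text \<open>The classical example \<open>18 = 2 \<cdot> 9\<close>, \<open>81 = 9 \<cdot> 9\<close> in base ten is an instance of a general fact: for
  \<open>2 \<le> c < b\<close>, in base
  \<open>b\<close>, reversing the two digits of \<open>c (b - 1)\<close> gives \<open>c' (b - 1)\<close> with \<open>c + c' = b + 1\<close>
  (lemma \<open>digit_reversal_multiple_pred_base\<close>). So one looks for a splitting of \<open>b + 1\<close> into two
  distinct parts whose products with \<open>b - 1\<close> have the same \<open>v\<close>.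

  If \<open>b + 1 = 11 m\<close>, the identity \<open>5 + 6 = 11\<close> gives the splitting \<open>5 m + 6 m\<close>. It suits \<open>v\<close> because
  \<open>v 5 = 5 = 2 + 3 = v 6\<close>: as \<open>v\<close> is additive on coprime factors (lemma \<open>v_mult_coprime\<close>),
  \<open>5 m (b - 1)\<close> and \<open>6 m (b - 1)\<close> have the same \<open>v\<close> as soon as \<open>m (b - 1)\<close> is coprime to \<open>30\<close>.
  The congruence \<open>b \<equiv> 120\<close> modulo \<open>330 = 11 \<cdot> 30\<close> says exactly that \<open>11\<close> divides \<open>b + 1\<close>
  and that \<open>30\<close> divides \<open>b\<close>; the latter makes both neighbours of \<open>b\<close>, hence \<open>m\<close> and \<open>b - 1\<close>,
  coprime to \<open>30\<close>.\<close>

lemma v_prime: "prime p \<Longrightarrow> v p = p"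
  by (simp add: v_def prime_prime_factors)

text \<open>A prime dividing one of two coprime factors occurs in the product with the exponent that it has
  in that factor, so the defining sum splits over the two disjoint sets of primes.\<close>

lemma v_mult_coprime:
  assumes "coprime m n" "m > 0" "n > 0"
  shows "v (m * n) = v m + v n"
proof -
  let ?f = "\<lambda>k p. if multiplicity p k \<ge> 2 then p + multiplicity p k else p"
  have disj: "prime_factors m \<inter> prime_factors n = {}"
    using assms(1) by (auto simp: in_prime_factors_iff dest: coprime_common_divisor_nat)
  have left: "?f (m * n) p = ?f m p" if "p \<in> prime_factors m" for p
  proof -
    have "multiplicity p n = 0"
      using that disj assms by (intro not_dvd_imp_multiplicity_0) (auto simp: in_prime_factors_iff)
    then show ?thesis
      using that assms by (simp add: in_prime_factors_iff prime_elem_multiplicity_mult_distrib)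
  qed
  have right: "?f (m * n) p = ?f n p" if "p \<in> prime_factors n" for p
  proof -
    have "multiplicity p m = 0"
      using that disj assms by (intro not_dvd_imp_multiplicity_0) (auto simp: in_prime_factors_iff)
    then show ?thesis
      using that assms by (simp add: in_prime_factors_iff prime_elem_multiplicity_mult_distrib)
  qed
  have "v (m * n) = (\<Sum>p\<in>prime_factors m \<union> prime_factors n. ?f (m * n) p)"
    using assms by (simp add: v_def prime_factors_product)
  also have "\<dots> = (\<Sum>p\<in>prime_factors m. ?f (m * n) p) + (\<Sum>p\<in>prime_factors n. ?f (m * n) p)"
    using disj by (intro sum.union_disjoint) auto
  also have "\<dots> = v m + v n"
    unfolding v_def using left right by (intro arg_cong2[where f = "(+)"] sum.cong) auto
  finally show ?thesis .
qed

text \<open>The digits of \<open>c (b - 1) = (c - 1) b + (b - c)\<close> are \<open>c - 1\<close> and \<open>b - c\<close>. The substitution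
  \<open>c \<mapsto> b + 1 - c\<close> interchanges them. The case \<open>c = 1\<close> is different, since the leading digit would be zero.\<close>

lemma digits_multiple_pred_base:
  assumes "2 \<le> c" "c < b"
  shows "digits b (c * (b - 1)) = [b - c, c - 1]"
proof (rule digits_eqI)
  obtain d e where "c = Suc d" "b = c + e"
    using assms by (metis Suc_le_D numeral_2_eq_2 less_imp_add_positive)
  then show "base_repr b (c * (b - 1)) [b - c, c - 1]"
    using assms by (auto simp: base_repr_def algebra_simps)
qed

lemma digit_reversal_multiple_pred_base:
  assumes "2 \<le> c" "c < b"
  shows "digit_reversal b (c * (b - 1)) = (b + 1 - c) * (b - 1)"
proof -
  obtain d e where "c = Suc d" "b = c + e"
    using assms by (metis Suc_le_D numeral_2_eq_2 less_imp_add_positive)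
  then show ?thesis
    unfolding digit_reversal_def digits_multiple_pred_base[OF assms]
    using assms by (simp add: algebra_simps)
qed

theorem corollary12:
  fixes b :: nat
  assumes "b > 0" and "[b = 120] (mod 330)"
  shows "\<exists>n. v_palindrome b n"
proof -
  have b_mod: "b mod 330 = 120"
    using assms(2) by (simp add: cong_def)
  then obtain k where k: "b = 330 * k + 120"
    by (metis mult_div_mod_eq)
  define m where "m = 30 * k + 11"
  have m: "b + 1 = 11 * m"
    by (simp add: k m_def)
  have "30 dvd b"
    by (simp add: k)
  have "m > 0" "b > 1"
    by (simp_all add: m_def k)
  define w where "w = m * (b - 1)"
  have "w > 0"
    using \<open>m > 0\<close> \<open>b > 1\<close> by (simp add: w_def)
  have "coprime b (b + 1)" "coprime b (b - 1)"
    using \<open>b > 1\<close> coprime_diff_one_left_nat[of b] by (simp_all add: coprime_commute)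
  then have "coprime b w"
    unfolding w_def m by simp
  then have "coprime 30 w"
    using \<open>30 dvd b\<close> by (rule coprime_divisors[OF _ dvd_refl, rotated])
  then have cop: "coprime 5 w" "coprime 6 w"
    by (rule coprime_divisors[OF _ dvd_refl, rotated]; simp)+
  have "v 6 = v (2 * 3)"
    by simp
  also have "\<dots> = 5"
    by (subst v_mult_coprime) (simp_all add: v_prime primes_coprime)
  finally have v_eq: "v (5 * w) = v (6 * w)"
    using cop \<open>w > 0\<close> by (simp add: v_mult_coprime v_prime)
  have rev: "digit_reversal b (5 * w) = 6 * w"
    using digit_reversal_multiple_pred_base[of "5 * m" b] m \<open>m > 0\<close>
    by (simp add: w_def mult.assoc)
  have "\<not> b dvd 5 * w"
  proof
    assume "b dvd 5 * w"
    then have "b dvd 5"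
      using \<open>coprime b w\<close> by (simp add: coprime_dvd_mult_left_iff)
    then show False
      using b_mod by (auto dest: dvd_imp_le)
  qed
  then have "v_palindrome b (5 * w)"
    using rev v_eq \<open>w > 0\<close> by (simp add: v_palindrome_def)
  then show ?thesis ..
qed

end
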